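(* Let $H_1$ and $H_2$ be non-null finite simple graphs and let $H$ be the disjoint union of $H_1$ and $H_2$. Then $$c(H)\le c(H_1)+c(H_2)+1.$$
   Context: Graphs are finite, simple and undirected. A graph is non-null if it has at least one vertex. For a graph $G$, $|G|$ denotes its number of vertices and $\|G\|$ its number of edges. A graph $H$ is a minor of $G$ if a graph isomorphic to $H$ can be obtained from a subgraph of $G$ by contracting edges. For a graph $H$, $c(H)$ is the supremum of $\|G\|/|G|$ taken over all non-null graphs $G$ not containing $H$ as a minor. (The supremum is taken in $[0,\infty)$, so that the supremum of the empty set, which occurs only when $H$ is a single vertex, is $0$.) *)

theory Defs
  imports Complex_Main
begin

(* A graph is a vertex set together with a set of edges, each edge a two-element vertex set. *)
type_synonym 'a ugraph = "'a set \<times> 'a set set"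

abbreviation verts :: "'a ugraph \<Rightarrow> 'a set" where
  "verts G \<equiv> fst G"

abbreviation edges :: "'a ugraph \<Rightarrow> 'a set set" where
  "edges G \<equiv> snd G"

definition simple_graph :: "'a ugraph \<Rightarrow> bool" where
  "simple_graph G \<longleftrightarrow> finite (verts G) \<and> (\<forall>e\<in>edges G. e \<subseteq> verts G \<and> card e = 2)"

definition non_null :: "'a ugraph \<Rightarrow> bool" where
  "non_null G \<longleftrightarrow> verts G \<noteq> {}"

definition graph_iso :: "'a ugraph \<Rightarrow> 'b ugraph \<Rightarrow> bool" where
  "graph_iso G H \<longleftrightarrow>
    (\<exists>f. bij_betw f (verts G) (verts H) \<and> edges H = (\<lambda>e. f ` e) ` edges G)"

definition is_subgraph :: "'a ugraph \<Rightarrow> 'a ugraph \<Rightarrow> bool" where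
  "is_subgraph S G \<longleftrightarrow> simple_graph S \<and> verts S \<subseteq> verts G \<and> edges S \<subseteq> edges G"

(* Contraction of the edge uv: the merged vertex keeps the name u. The edge uv would become the
   loop {u} and is dropped; parallel edges coincide because the edges form a set. *)
definition contract_edge :: "'a \<Rightarrow> 'a \<Rightarrow> 'a ugraph \<Rightarrow> 'a ugraph" where
  "contract_edge u v G =
    (verts G - {v},
     (\<lambda>e. (\<lambda>x. if x = v then u else x) ` e) ` (edges G - {{u, v}}))"

definition contracts_to :: "'a ugraph \<Rightarrow> 'a ugraph \<Rightarrow> bool" where
  "contracts_to G G' \<longleftrightarrow> (\<exists>u v. {u, v} \<in> edges G \<and> G' = contract_edge u v G)"

definition is_minor :: "'a ugraph \<Rightarrow> 'b ugraph \<Rightarrow> bool" where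
  "is_minor H G \<longleftrightarrow>
    (\<exists>S M. is_subgraph S G \<and> contracts_to\<^sup>*\<^sup>* S M \<and> graph_iso M H)"

definition disjoint_union :: "'a ugraph \<Rightarrow> 'b ugraph \<Rightarrow> ('a + 'b) ugraph" where
  "disjoint_union G H =
    (verts G <+> verts H, (\<lambda>e. Inl ` e) ` edges G \<union> (\<lambda>e. Inr ` e) ` edges H)"

(* The extremal constant c(H). Every finite graph is isomorphic to one with vertices in nat, so G ranges over those.
   The densities are nonnegative; inserting 0 only makes the supremum of the empty set equal
   to 0. For every finite simple graph H the set is bounded above (Mader), so the real Sup is the
   genuine supremum. *)
definition minor_density :: "'a ugraph \<Rightarrow> real" where
  "minor_density H = Sup (insert 0
    {real (card (edges G)) / real (card (verts G)) | G :: nat ugraph.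
      simple_graph G \<and> non_null G \<and> \<not> is_minor H G})"

lemma simple_graph_contract_edge:
  assumes "simple_graph G" "{u, v} \<in> edges G"
  shows "simple_graph (contract_edge u v G)"
proof -
  let ?r = "\<lambda>x. if x = v then u else x"
  have "{u, v} \<subseteq> verts G" "card {u, v} = 2"
    using assms unfolding simple_graph_def by blast+
  then have uv: "u \<noteq> v" "u \<in> verts G" "v \<in> verts G"
    by (simp_all add: card_insert_if split: if_splits)
  have img: "?r ` e \<subseteq> verts G - {v} \<and> card (?r ` e) = 2"
    if e: "e \<in> edges G" "e \<noteq> {u, v}" for e
  proof -
    have ce: "card e = 2" and se: "e \<subseteq> verts G"
      using assms(1) e(1) unfolding simple_graph_def by blast+
    obtain a b where ab: "e = {a, b}" "a \<noteq> b"
      using ce by (meson card_2_iff)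
    have "?r a \<noteq> ?r b"
      using ab e(2) by (cases "a = v"; cases "b = v") (auto simp: insert_commute)
    then have "card (?r ` e) = 2"
      unfolding ab(1) image_insert image_empty card_2_iff by blast
    moreover have "?r ` e \<subseteq> verts G - {v}"
      using uv se by (simp add: image_subset_iff) blast
    ultimately show ?thesis by blast
  qed
  show ?thesis
    unfolding simple_graph_def
  proof (intro conjI ballI)
    show "finite (verts (contract_edge u v G))"
      using assms(1) by (simp add: simple_graph_def contract_edge_def)
  next
    fix e assume "e \<in> edges (contract_edge u v G)"
    then obtain d where d: "d \<in> edges G" "d \<noteq> {u, v}" "e = ?r ` d"
      unfolding contract_edge_def snd_conv by blast
    show "e \<subseteq> verts (contract_edge u v G)" "card e = 2"
      using img[OF d(1,2)] d(3) unfolding contract_edge_def fst_conv by blast+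
  qed
qed

lemma simple_graph_disjoint_union:
  assumes "simple_graph G" "simple_graph H"
  shows "simple_graph (disjoint_union G H)"
  unfolding simple_graph_def
proof (intro conjI ballI)
  show "finite (verts (disjoint_union G H))"
    using assms by (simp add: simple_graph_def disjoint_union_def)
next
  fix e assume "e \<in> edges (disjoint_union G H)"
  then consider d where "d \<in> edges G" "e = Inl ` d" | d where "d \<in> edges H" "e = Inr ` d"
    unfolding disjoint_union_def snd_conv by blast
  then have "e \<subseteq> verts (disjoint_union G H) \<and> card e = 2"
  proof cases
    case 1
    then have "d \<subseteq> verts G" "card d = 2"
      using assms(1) unfolding simple_graph_def by blast+
    with 1 show ?thesis
      unfolding disjoint_union_def fst_conv by (simp add: card_image) blast
  next
    case 2
    then have "d \<subseteq> verts H" "card d = 2"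
      using assms(2) unfolding simple_graph_def by blast+
    with 2 show ?thesis
      unfolding disjoint_union_def fst_conv by (simp add: card_image) blast
  qed
  then show "e \<subseteq> verts (disjoint_union G H)" "card e = 2" by blast+
qed

end

theory Submission
  imports Defs
begin

text \<open>
  Write $e(W)$ for the number of edges inside a vertex set $W$. The theorem rests on a statement about
  subgraphs only (\<open>dense_bipartition\<close>): if a non-null graph with $n$ vertices and $m$ edges satisfies
  $m \ge (s+t+1)n$, where $s > 0$ and $t \ge 0$, then its vertex set splits into two non-empty parts $A$, $B$
  with $e(A) \ge s|A|$ and $e(B) \ge t|B|$. A graph with more than $(c(H_1)+c(H_2)+1)n$ edges
  satisfies this with $s$ slightly above $c(H_1)$ and $t$ slightly above $c(H_2)$. Then the two parts
  induce graphs that have $H_1$ and $H_2$ as minors, and since the parts are disjoint, these minors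
  combine to a minor isomorphic to the disjoint union.

  The split is found by deleting vertices one at a time. Put $D = m/n$, let $W$ have $j$ elements, and
  let $\delta(W)$ be the sum of the degrees, in the whole graph, of the vertices in $W$. The quantity
  \[ \Lambda(W) = \frac{(n-1)\,e(W)}{j-1} + Dj - \delta(W) \]
  vanishes on the whole vertex set, and the sum of $\Lambda(W - u)$ over $u \in W$ is
  $(j-1)\Lambda(W)$. So vertices can be deleted in such an order that $\Lambda$ stays non-negative.
  At the start $e(W) \ge (s+1)(j-1)$; stop at the first set $A$, of size $k$, that has
  $e(A) < (s+1)(k-1)$; there is one, as two vertices span at most one edge. The last deletion
  destroyed at most $k$ edges, and before it there were at least $(s+1)k$ of them, hence
  $e(A) \ge sk$. Because of
  $\delta(A) = m + e(A) - e(B)$ for the complement $B$, the inequality $\Lambda(A) \ge 0$ reads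
  \[ (n-k)\frac{e(A)}{k-1} + e(B) \ge D(n-k), \]
  and with $e(A)/(k-1) < s+1$ and $D \ge s+t+1$ this forces $e(B) \ge t(n-k)$.

  The constant $c(H)$ is a supremum of real numbers, so to conclude from a density above $c(H)$ that
  $H$ is a minor, one needs the set of densities to be bounded. This is Mader's theorem, in the form
  that density $2^p$ forces a complete minor on $p$ vertices (\<open>dense_graph_complete_minor\<close>): in a minor that is
  vertex-minimal with that density, both ends of every edge have many common neighbours, so the neighbourhood
  of a vertex is dense enough for induction, and the vertex itself extends the complete minor found there.
\<close>

section \<open>Edges inside a vertex set\<close>

definition induced :: "'a ugraph \<Rightarrow> 'a set \<Rightarrow> 'a ugraph" where
  "induced G W = (W, {e \<in> edges G. e \<subseteq> W})"

definition degree :: "'a ugraph \<Rightarrow> 'a \<Rightarrow> nat" where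
  "degree G u = card {e \<in> edges G. u \<in> e}"

abbreviation inner_edges :: "'a ugraph \<Rightarrow> 'a set \<Rightarrow> nat" where
  "inner_edges G W \<equiv> card (edges (induced G W))"

lemma simple_graph_finite:
  assumes "simple_graph G"
  shows "finite (verts G)" "finite (edges G)"
proof -
  show "finite (verts G)" using assms by (simp add: simple_graph_def)
  moreover have "edges G \<subseteq> Pow (verts G)"
    using assms by (auto simp: simple_graph_def)
  ultimately show "finite (edges G)" by (meson finite_Pow_iff finite_subset)
qed

lemma card_verts_pos:
  assumes "simple_graph G" "non_null G"
  shows "0 < card (verts G)"
  using simple_graph_finite(1)[OF assms(1)] assms(2) by (simp add: non_null_def card_gt_0_iff)

lemma simple_graph_edgeD:
  assumes "simple_graph G" "e \<in> edges G"
  shows "e \<subseteq> verts G" "card e = 2"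
  using assms by (simp_all add: simple_graph_def)

lemma simple_graph_edgeE:
  assumes "simple_graph G" "{u, v} \<in> edges G"
  shows "u \<noteq> v" "u \<in> verts G" "v \<in> verts G"
  using simple_graph_edgeD[OF assms] by (auto simp: card_insert_if split: if_splits)

lemma induced_is_subgraph:
  assumes "simple_graph G" "W \<subseteq> verts G"
  shows "is_subgraph (induced G W) G"
  using assms finite_subset[OF assms(2)]
  by (auto simp: is_subgraph_def simple_graph_def induced_def)

lemma simple_graph_induced:
  assumes "simple_graph G" "W \<subseteq> verts G"
  shows "simple_graph (induced G W)"
  using induced_is_subgraph[OF assms] by (simp add: is_subgraph_def)

lemma induced_verts:
  assumes "simple_graph G"
  shows "induced G (verts G) = G"
  using assms by (auto simp: induced_def simple_graph_def prod_eq_iff)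

lemma inner_edges_card_le_1:
  assumes "simple_graph G" "finite W" "card W \<le> 1"
  shows "inner_edges G W = 0"
proof -
  have "\<not> e \<subseteq> W" if "e \<in> edges G" for e
    using card_mono[OF assms(2), of e] simple_graph_edgeD(2)[OF assms(1) that] assms(3) by auto
  then have "edges (induced G W) = {}" by (auto simp: induced_def)
  then show ?thesis by simp
qed

text \<open>
  Both sides count each edge once for every end that it has in \<open>W\<close>, and the edges that avoid \<open>W\<close>
  once more.
\<close>
lemma sum_degree:
  assumes G: "simple_graph G" and W: "W \<subseteq> verts G"
  shows "(\<Sum>u\<in>W. degree G u) + inner_edges G (verts G - W) = card (edges G) + inner_edges G W"
proof -
  note fin = simple_graph_finite[OF G]
  have finW: "finite W" using W fin finite_subset by blast
  have ind: "card {e \<in> edges G. P e} = (\<Sum>e\<in>edges G. if P e then 1 else 0)" for P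
    using fin by (simp add: sum.If_cases Int_def)
  have count: "card (e \<inter> W) + (if e \<subseteq> verts G - W then 1 else 0) = 1 + (if e \<subseteq> W then 1 else 0)"
    if e: "e \<in> edges G" for e
  proof -
    obtain a b where ab: "e = {a, b}" "a \<noteq> b"
      using simple_graph_edgeD(2)[OF G e] by (meson card_2_iff)
    show ?thesis
      using ab simple_graph_edgeD(1)[OF G e]
      by (cases "a \<in> W"; cases "b \<in> W") auto
  qed
  have "(\<Sum>u\<in>W. degree G u) = (\<Sum>u\<in>W. \<Sum>e\<in>edges G. if u \<in> e then 1 else 0)"
    by (simp add: degree_def ind)
  also have "\<dots> = (\<Sum>e\<in>edges G. \<Sum>u\<in>W. if u \<in> e then 1 else 0)"
    by (rule sum.swap)
  also have "\<dots> = (\<Sum>e\<in>edges G. card (e \<inter> W))"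
    using finW by (intro sum.cong refl) (simp add: sum.If_cases Int_commute)
  finally have deg: "(\<Sum>u\<in>W. degree G u) = (\<Sum>e\<in>edges G. card (e \<inter> W))" .
  have "(\<Sum>u\<in>W. degree G u) + inner_edges G (verts G - W)
      = (\<Sum>e\<in>edges G. card (e \<inter> W) + (if e \<subseteq> verts G - W then 1 else 0))"
    by (simp add: deg induced_def ind sum.distrib)
  also have "\<dots> = (\<Sum>e\<in>edges G. 1 + (if e \<subseteq> W then 1 else 0))"
    using count by (intro sum.cong refl)
  also have "\<dots> = card (edges G) + inner_edges G W"
    by (simp only: sum.distrib induced_def ind snd_conv) simp
  finally show ?thesis .
qed

lemma handshake:
  assumes "simple_graph G"
  shows "(\<Sum>u\<in>verts G. degree G u) = 2 * card (edges G)"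
  using sum_degree[OF assms order_refl] inner_edges_card_le_1[OF assms, of "{}"]
  by (simp add: induced_verts[OF assms])

lemma inner_edges_remove:
  assumes "simple_graph G" "W \<subseteq> verts G"
  shows "inner_edges G (W - {u}) + degree (induced G W) u = inner_edges G W"
proof -
  have "edges (induced G W) = edges (induced G (W - {u})) \<union> {e \<in> edges (induced G W). u \<in> e}"
    by (auto simp: induced_def)
  moreover have "edges (induced G (W - {u})) \<inter> {e \<in> edges (induced G W). u \<in> e} = {}"
    by (auto simp: induced_def)
  moreover have "finite (edges (induced G W))"
    using simple_graph_finite(2)[OF simple_graph_induced[OF assms]] .
  ultimately show ?thesis
    unfolding degree_def by (metis (no_types, lifting) card_Un_disjoint finite_Un)
qed

lemma degree_eq_card_neighbours:
  assumes "simple_graph G"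
  shows "degree G u = card {x. {u, x} \<in> edges G}"
proof -
  have "{e \<in> edges G. u \<in> e} = (\<lambda>x. {u, x}) ` {x. {u, x} \<in> edges G}"
  proof (intro equalityI subsetI)
    fix e assume e: "e \<in> {e \<in> edges G. u \<in> e}"
    then obtain a b where "e = {a, b}"
      using simple_graph_edgeD(2)[OF assms] by (metis (no_types, lifting) card_2_iff mem_Collect_eq)
    with e show "e \<in> (\<lambda>x. {u, x}) ` {x. {u, x} \<in> edges G}"
      by (auto simp: insert_commute)
  qed auto
  moreover have "inj_on (\<lambda>x. {u, x}) A" for A
    by (auto simp: inj_on_def doubleton_eq_iff)
  ultimately show ?thesis by (simp add: degree_def card_image)
qed

lemma degree_le:
  assumes "simple_graph G" "u \<in> verts G"
  shows "degree G u \<le> card (verts G) - 1"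
proof -
  have "{x. {u, x} \<in> edges G} \<subseteq> verts G - {u}"
    using simple_graph_edgeE[OF assms(1)] by blast
  then have "card {x. {u, x} \<in> edges G} \<le> card (verts G - {u})"
    using simple_graph_finite[OF assms(1)] by (intro card_mono) auto
  then show ?thesis using assms by (simp add: degree_eq_card_neighbours)
qed

section \<open>Splitting a dense graph into two dense parts\<close>

text \<open>
  The induction behind the split: \<open>W\<close> is the current set in the deletion process, \<open>excess\<close> is the
  invariant $\Lambda(W) \ge 0$, and \<open>dense\<close> says that the process has not stopped yet. Only the value of
  \<open>D\<close> on the whole graph enters, which is why the graph stays fixed while \<open>W\<close> shrinks.
\<close>
lemma bipartition_by_peeling:
  fixes D s t :: real
  assumes G: "simple_graph G" and s: "0 < s"
    and D: "real (card (edges G)) = D * card (verts G)" "s + t + 1 \<le> D"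
    and W: "W \<subseteq> verts G" "2 \<le> card W"
    and dense: "(s + 1) * (real (card W) - 1) \<le> inner_edges G W"
    and excess: "(\<Sum>u\<in>W. real (degree G u))
      \<le> (real (card (verts G)) - 1) * (inner_edges G W / (real (card W) - 1)) + D * card W"
  shows "\<exists>A. A \<subset> verts G \<and> A \<noteq> {} \<and> s * card A \<le> inner_edges G A
    \<and> t * card (verts G - A) \<le> inner_edges G (verts G - A)"
  using W dense excess
proof (induction "card W" arbitrary: W rule: less_induct)
  case less
  define n where "n = real (card (verts G))"
  define j where "j = real (card W)"
  define e where "e = real (inner_edges G W)"
  let ?d = "\<lambda>u. real (degree G u)"
  let ?dW = "\<lambda>u. real (degree (induced G W) u)"
  note finV = simple_graph_finite(1)[OF G]
  have finW: "finite W" using less.prems(1) finV finite_subset by blast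
  have remove: "real (inner_edges G (W - {u})) = e - ?dW u" for u
    using inner_edges_remove[OF G less.prems(1), of u] by (simp add: e_def)
  have dW_le: "?dW u \<le> j - 1" if "u \<in> W" for u
    using degree_le[OF simple_graph_induced[OF G less.prems(1)], of u] that less.prems(2)
    by (simp add: induced_def j_def)
  have cardW': "real (card (W - {u})) = j - 1" if "u \<in> W" for u
    using that finW less.prems(2) by (simp add: j_def)
  \<comment> \<open>Two vertices span at most one edge, fewer than \<open>s + 1\<close>. Below, \<open>j - 2\<close> is a denominator.\<close>
  have "j \<noteq> 2"
  proof
    assume j2: "j = 2"
    obtain u where u: "u \<in> W" using less.prems(2) by fastforce
    have "inner_edges G (W - {u}) = 0"
      using cardW'[OF u] j2 finW by (intro inner_edges_card_le_1[OF G]) auto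
    then have "e \<le> 1" using remove[of u] dW_le[OF u] j2 by simp
    then show False using less.prems(3) s j2 by (simp add: e_def j_def)
  qed
  then have j3: "3 \<le> j" using less.prems(2) by (simp add: j_def)
  \<comment> \<open>\<open>gain u\<close> is $\Lambda(W - u)$. An edge inside \<open>W\<close> lies inside \<open>W - {u}\<close> for \<open>j - 2\<close> of the \<open>j\<close>
    choices of \<open>u\<close>, and a vertex for \<open>j - 1\<close> of them, so the sum over \<open>u\<close> is $(j-1)\Lambda(W)$.\<close>
  define gain where
    "gain u = (n - 1) * ((e - ?dW u) / (j - 2)) + D * (j - 1) - ((\<Sum>w\<in>W. ?d w) - ?d u)" for u
  have sum_dW: "(\<Sum>u\<in>W. ?dW u) = 2 * e"
    using handshake[OF simple_graph_induced[OF G less.prems(1)]]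
    by (simp add: e_def flip: of_nat_sum) (simp add: induced_def)
  have "(\<Sum>u\<in>W. gain u)
      = (n - 1) * ((j * e - 2 * e) / (j - 2)) + j * (D * (j - 1)) - (j * (\<Sum>w\<in>W. ?d w) - (\<Sum>w\<in>W. ?d w))"
    unfolding gain_def
    by (simp add: sum.distrib sum_subtractf sum_dW j_def flip: sum_distrib_left sum_divide_distrib)
  also have "(j * e - 2 * e) / (j - 2) = e" using j3 by (simp add: field_simps)
  also have "(n - 1) * e + j * (D * (j - 1)) - (j * (\<Sum>w\<in>W. ?d w) - (\<Sum>w\<in>W. ?d w))
      = (j - 1) * ((n - 1) * (e / (j - 1)) + D * j - (\<Sum>w\<in>W. ?d w))"
    using j3 by (simp add: field_simps)
  finally have "(\<Sum>u\<in>W. gain u) \<ge> 0"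
    using less.prems(4) j3 by (simp add: n_def e_def j_def)
  then obtain u where u: "u \<in> W" "gain u \<ge> 0"
    using sum_strict_mono[of W gain "\<lambda>_. 0"] finW less.prems(2) by force
  define A where "A = W - {u}"
  define k where "k = real (card A)"
  define f where "f = real (inner_edges G A)"
  have k: "k = j - 1" using cardW'[OF u(1)] by (simp add: k_def A_def)
  have f: "f = e - ?dW u" using remove by (simp add: f_def A_def)
  have "A \<noteq> {}" using k j3 by (auto simp: k_def)
  then have A: "A \<subset> verts G" "A \<noteq> {}"
    using u(1) less.prems(1) by (auto simp: A_def)
  have sumA: "(\<Sum>w\<in>A. ?d w) = (\<Sum>w\<in>W. ?d w) - ?d u"
    using u(1) finW by (simp add: A_def sum_diff1)
  have exA: "(\<Sum>w\<in>A. ?d w) \<le> (n - 1) * (f / (k - 1)) + D * k"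
    using u(2) unfolding gain_def sumA f k by (simp add: algebra_simps)
  show ?case
  proof (cases "(s + 1) * (k - 1) \<le> f")
    case True
    have "card A < card W" using card_Diff1_less[OF finW u(1)] by (simp add: A_def)
    moreover have "2 \<le> card A" using k j3 by (simp add: k_def)
    ultimately show ?thesis
      using less.hyps[of A] A(1) True exA by (simp add: k_def f_def n_def)
  next
    case False
    define B where "B = verts G - A"
    define g where "g = real (inner_edges G B)"
    \<comment> \<open>\<open>W\<close> has at least \<open>(s + 1) * k\<close> edges, and \<open>u\<close> lies on at most \<open>k\<close> of them.\<close>
    have "s * k \<le> f"
      using less.prems(3) dW_le[OF u(1)] unfolding f k e_def[symmetric] j_def[symmetric]
      by (simp add: algebra_simps)
    moreover have "t * card B \<le> g"
    proof (rule ccontr)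
      assume "\<not> t * card B \<le> g"
      moreover have cB: "real (card B) = n - k"
        using A(1) finV finite_subset[of A "verts G"] card_mono[of "verts G" A]
        by (auto simp: B_def n_def k_def card_Diff_subset)
      ultimately have g: "g < t * (n - k)" by simp
      have nk: "0 < n - k"
        using psubset_card_mono[OF finV A(1)] by (simp add: n_def k_def)
      have "real ((\<Sum>w\<in>A. degree G w) + inner_edges G B) = D * n + f"
        using sum_degree[OF G, of A] A(1) D(1) by (simp add: B_def n_def f_def)
      then have ex: "D * n + f - g \<le> (n - 1) * (f / (k - 1)) + D * k"
        using exA by (simp add: g_def)
      define q where "q = f / (k - 1)"
      have fq: "f = q * (k - 1)" using k j3 by (simp add: q_def)
      have "D * n + q * (k - 1) - g \<le> (n - 1) * q + D * k"
        using ex unfolding q_def[symmetric] fq[symmetric] .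
      then have "D * (n - k) \<le> q * (n - k) + g" by (simp add: algebra_simps)
      moreover have "0 < k - 1" using k j3 by simp
      then have "q < s + 1" using False unfolding q_def by (subst pos_divide_less_eq) auto
      then have "q * (n - k) < (s + 1) * (n - k)" using nk by simp
      moreover have "(s + t + 1) * (n - k) \<le> D * (n - k)" using D(2) nk by simp
      ultimately show False using g by (simp add: algebra_simps)
    qed
    ultimately show ?thesis using A unfolding B_def g_def k_def f_def by blast
  qed
qed

lemma dense_bipartition:
  fixes s t :: real
  assumes G: "simple_graph G" "non_null G" and s: "0 < s" and t: "0 \<le> t"
    and dense: "(s + t + 1) * card (verts G) \<le> card (edges G)"
  shows "\<exists>A. A \<subset> verts G \<and> A \<noteq> {} \<and> s * card A \<le> inner_edges G A
    \<and> t * card (verts G - A) \<le> inner_edges G (verts G - A)"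
proof -
  define n where "n = card (verts G)"
  have n0: "n > 0" using card_verts_pos[OF G] by (simp add: n_def)
  have "n \<noteq> 1"
    using inner_edges_card_le_1[OF G(1), of "verts G"] simple_graph_finite(1)[OF G(1)] dense s t
    by (auto simp: n_def induced_verts[OF G(1)])
  then have n2: "2 \<le> n" using n0 by simp
  define D where "D = card (edges G) / n"
  have D: "real (card (edges G)) = D * n" "s + t + 1 \<le> D"
    using dense n0 by (simp_all add: D_def n_def field_simps)
  have "(s + 1) * (real n - 1) \<le> (s + t + 1) * n"
    using s t n0 by (intro mult_mono) auto
  then have start: "(s + 1) * (real n - 1) \<le> card (edges G)"
    using dense by (simp add: n_def)
  have "(\<Sum>u\<in>verts G. real (degree G u)) = 2 * card (edges G)"
    using handshake[OF G(1)] by (simp flip: of_nat_sum)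
  then show ?thesis
    using bipartition_by_peeling[OF G(1) s, of D t "verts G"] D n2 start
    by (simp add: n_def induced_verts[OF G(1)])
qed

section \<open>Minors\<close>

text \<open>
  The minor relation for graphs on one vertex type, without the final renaming of the vertices. Splitting
  off the isomorphism makes the relation transitive and leaves the contraction steps with concrete graphs.
\<close>
definition reduces_to :: "'a ugraph \<Rightarrow> 'a ugraph \<Rightarrow> bool" where
  "reduces_to G M \<longleftrightarrow> (\<exists>S. is_subgraph S G \<and> contracts_to\<^sup>*\<^sup>* S M)"

lemma is_minor_iff: "is_minor H G \<longleftrightarrow> (\<exists>M. reduces_to G M \<and> graph_iso M H)"
  by (auto simp: is_minor_def reduces_to_def)

lemma contracts_to_simple:
  assumes "contracts_to\<^sup>*\<^sup>* S M" "simple_graph S"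
  shows "simple_graph M \<and> verts M \<subseteq> verts S"
  using assms
proof (induction rule: rtranclp_induct)
  case (step M M')
  then show ?case
    by (auto simp: contracts_to_def simple_graph_contract_edge) (auto simp: contract_edge_def)
qed simp

lemma reduces_to_simple: "reduces_to G M \<Longrightarrow> simple_graph M \<and> verts M \<subseteq> verts G"
  using contracts_to_simple unfolding reduces_to_def is_subgraph_def by blast

lemma is_subgraph_trans: "is_subgraph S T \<Longrightarrow> is_subgraph T G \<Longrightarrow> is_subgraph S G"
  by (auto simp: is_subgraph_def)

text \<open>
  Deleting after contracting can be replaced by deleting before contracting. If the merged vertex
  \<open>u\<close> is deleted, then \<open>T\<close> is already a subgraph of \<open>S\<close>. Otherwise \<open>T\<close> arises by contracting \<open>uv\<close> in
  the graph of all edges of \<open>S\<close> that become edges of \<open>T\<close>, together with \<open>uv\<close>.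
\<close>
lemma subgraph_of_contraction:
  assumes S: "simple_graph S" "{u, v} \<in> edges S" and T: "is_subgraph T (contract_edge u v S)"
  shows "reduces_to S T"
proof -
  define r where "r x = (if x = v then u else x)" for x
  note uv = simple_graph_edgeE[OF S]
  have Tv: "verts T \<subseteq> verts S - {v}" and Te: "edges T \<subseteq> (\<lambda>e. r ` e) ` (edges S - {{u, v}})"
    and Ts: "simple_graph T"
    using T by (auto simp: is_subgraph_def contract_edge_def r_def)
  have r_id: "r ` e = e" if "v \<notin> e" for e
    using that by (force simp: r_def)
  show ?thesis
  proof (cases "u \<in> verts T")
    case False
    have "e \<in> edges S" if e: "e \<in> edges T" for e
    proof -
      obtain d where d: "d \<in> edges S" "e = r ` d" using Te e by blast
      have "u \<notin> e" using simple_graph_edgeD(1)[OF Ts e] False by blast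
      then have "v \<notin> d" using d(2) by (auto simp: r_def)
      then show ?thesis using d r_id by metis
    qed
    then have "is_subgraph T S" using Ts Tv by (auto simp: is_subgraph_def)
    then show ?thesis unfolding reduces_to_def by blast
  next
    case True
    define P where "P = (insert v (verts T), insert {u, v} {e \<in> edges S. r ` e \<in> edges T})"
    have inside: "e \<subseteq> insert v (verts T)" if "r ` e \<in> edges T" for e
      using simple_graph_edgeD(1)[OF Ts that] by (auto simp: r_def split: if_splits)
    have "is_subgraph P S"
      using inside Tv uv S(1,2) True simple_graph_finite(1)[OF Ts] simple_graph_edgeD(2)[OF S(1)]
      by (auto simp: is_subgraph_def P_def simple_graph_def)
    moreover have "contract_edge u v P = T"
    proof -
      have "(\<lambda>e. r ` e) ` ({e \<in> edges S. r ` e \<in> edges T} - {{u, v}}) = edges T"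
        using Te by blast
      then show ?thesis
        using Tv by (auto simp: contract_edge_def P_def prod_eq_iff insert_Diff_if r_def[abs_def])
    qed
    then have "contracts_to P T"
      unfolding contracts_to_def by (metis P_def insertI1 snd_conv)
    ultimately show ?thesis unfolding reduces_to_def by blast
  qed
qed

lemma subgraph_of_contractions:
  assumes "contracts_to\<^sup>*\<^sup>* S M" "simple_graph S" "is_subgraph T M"
  shows "reduces_to S T"
  using assms
proof (induction arbitrary: T rule: rtranclp_induct)
  case base
  then show ?case unfolding reduces_to_def by blast
next
  case (step M M')
  have M: "simple_graph M" using contracts_to_simple step.hyps(1) step.prems(1) by blast
  obtain u v where uv: "{u, v} \<in> edges M" "M' = contract_edge u v M"
    using step.hyps(2) unfolding contracts_to_def by blast
  have "reduces_to M T"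
    using subgraph_of_contraction[OF M uv(1)] step.prems(2) uv(2) by simp
  then obtain P where P: "is_subgraph P M" "contracts_to\<^sup>*\<^sup>* P T" unfolding reduces_to_def by blast
  then show ?case
    using step.IH[OF step.prems(1) P(1)] unfolding reduces_to_def by (meson rtranclp_trans)
qed

lemma reduces_to_trans:
  assumes "reduces_to G M" "reduces_to M T"
  shows "reduces_to G T"
proof -
  obtain S P where S: "is_subgraph S G" "contracts_to\<^sup>*\<^sup>* S M" and P: "is_subgraph P M" "contracts_to\<^sup>*\<^sup>* P T"
    using assms unfolding reduces_to_def by blast
  have "reduces_to S P"
    using subgraph_of_contractions[OF S(2) _ P(1)] S(1) by (simp add: is_subgraph_def)
  then show ?thesis
    using S(1) P(2) is_subgraph_trans unfolding reduces_to_def by (meson rtranclp_trans)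
qed

definition graph_union :: "'a ugraph \<Rightarrow> 'a ugraph \<Rightarrow> 'a ugraph" where
  "graph_union S R = (verts S \<union> verts R, edges S \<union> edges R)"

text \<open>Contractions in one of two vertex-disjoint graphs do not touch the other one.\<close>
lemma contracts_to_graph_union:
  assumes "contracts_to\<^sup>*\<^sup>* S M" "simple_graph S" "simple_graph R" "verts S \<inter> verts R = {}"
  shows "contracts_to\<^sup>*\<^sup>* (graph_union S R) (graph_union M R)"
  using assms
proof (induction rule: rtranclp_induct)
  case (step M M')
  have M: "simple_graph M" "verts M \<inter> verts R = {}"
    using contracts_to_simple[OF step.hyps(1) step.prems(1)] step.prems(3) by blast+
  obtain u v where uv: "{u, v} \<in> edges M" "M' = contract_edge u v M"
    using step.hyps(2) unfolding contracts_to_def by blast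
  have v: "v \<notin> verts R" using simple_graph_edgeE[OF M(1) uv(1)] M(2) by blast
  have fixed: "(\<lambda>x. if x = v then u else x) ` e = e" if "e \<in> edges R" for e
    using v simple_graph_edgeD(1)[OF step.prems(2) that] by force
  have "{u, v} \<notin> edges R" using v simple_graph_edgeE[OF step.prems(2)] by blast
  then have "contract_edge u v (graph_union M R) = graph_union M' R"
    unfolding uv(2) contract_edge_def graph_union_def using v fixed
    by (auto simp: Un_Diff image_Un cong: image_cong)
  then have "contracts_to (graph_union M R) (graph_union M' R)"
    unfolding contracts_to_def using uv(1) by (metis UnI1 graph_union_def snd_conv)
  then show ?case using step by (meson rtranclp.rtrancl_into_rtrancl)
qed simp

lemma graph_union_commute: "graph_union S R = graph_union R S"
  by (auto simp: graph_union_def)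

lemma graph_iso_disjoint_union:
  assumes M: "simple_graph M1" "simple_graph M2" "verts M1 \<inter> verts M2 = {}"
    and iso: "graph_iso M1 H1" "graph_iso M2 H2"
  shows "graph_iso (graph_union M1 M2) (disjoint_union H1 H2)"
proof -
  obtain f where f: "bij_betw f (verts M1) (verts H1)" "edges H1 = (\<lambda>e. f ` e) ` edges M1"
    using iso(1) unfolding graph_iso_def by (elim exE conjE)
  obtain g where g: "bij_betw g (verts M2) (verts H2)" "edges H2 = (\<lambda>e. g ` e) ` edges M2"
    using iso(2) unfolding graph_iso_def by (elim exE conjE)
  define h where "h x = (if x \<in> verts M1 then Inl (f x) else Inr (g x))" for x
  have h1: "h ` e = (\<lambda>x. Inl (f x)) ` e" if "e \<subseteq> verts M1" for e
    using that by (force simp: h_def)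
  have h2: "h ` e = (\<lambda>x. Inr (g x)) ` e" if "e \<subseteq> verts M2" for e
    using that M(3) by (force simp: h_def)
  have "inj_on h (verts M1 \<union> verts M2)"
    using bij_betw_imp_inj_on[OF f(1)] bij_betw_imp_inj_on[OF g(1)]
    by (auto simp: inj_on_def h_def)
  moreover have "h ` (verts M1 \<union> verts M2) = verts H1 <+> verts H2"
    using bij_betw_imp_surj_on[OF f(1)] bij_betw_imp_surj_on[OF g(1)]
    by (simp add: image_Un h1 h2 Plus_def flip: image_image)
  moreover have "(\<lambda>e. h ` e) ` edges M1 = (\<lambda>e. Inl ` e) ` edges H1"
    unfolding f(2) image_comp comp_def by (intro image_cong refl h1 simple_graph_edgeD(1)[OF M(1)])
  moreover have "(\<lambda>e. h ` e) ` edges M2 = (\<lambda>e. Inr ` e) ` edges H2"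
    unfolding g(2) image_comp comp_def by (intro image_cong refl h2 simple_graph_edgeD(1)[OF M(2)])
  ultimately show ?thesis
    unfolding graph_iso_def graph_union_def disjoint_union_def bij_betw_def
    by (intro exI[of _ h]) (simp add: image_Un)
qed

text \<open>
  The contractions are carried out one after the other: those in \<open>S1\<close> while \<open>S2\<close> is untouched, and then those in
  \<open>S2\<close> while \<open>M1\<close>, the result of the first, stays in place.
\<close>
lemma is_minor_disjoint_union:
  assumes G1: "is_subgraph G1 G" and G2: "is_subgraph G2 G" and disj: "verts G1 \<inter> verts G2 = {}"
    and minors: "is_minor H1 G1" "is_minor H2 G2"
  shows "is_minor (disjoint_union H1 H2) G"
proof -
  obtain S1 M1 S2 M2 where
    1: "is_subgraph S1 G1" "contracts_to\<^sup>*\<^sup>* S1 M1" "graph_iso M1 H1" and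
    2: "is_subgraph S2 G2" "contracts_to\<^sup>*\<^sup>* S2 M2" "graph_iso M2 H2"
    using minors unfolding is_minor_def by blast
  have S: "simple_graph S1" "simple_graph S2" "verts S1 \<inter> verts S2 = {}"
    using 1(1) 2(1) disj by (auto simp: is_subgraph_def)
  note M1 = contracts_to_simple[OF 1(2) S(1)] and M2 = contracts_to_simple[OF 2(2) S(2)]
  have "is_subgraph (graph_union S1 S2) G"
    using is_subgraph_trans[OF 1(1) G1] is_subgraph_trans[OF 2(1) G2]
    by (auto simp: is_subgraph_def graph_union_def simple_graph_def)
  moreover have "contracts_to\<^sup>*\<^sup>* (graph_union S1 S2) (graph_union M1 S2)"
    by (rule contracts_to_graph_union[OF 1(2) S])
  moreover have "contracts_to\<^sup>*\<^sup>* (graph_union S2 M1) (graph_union M2 M1)"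
    using contracts_to_graph_union[OF 2(2) S(2), of M1] M1 S(3) by blast
  moreover have "graph_iso (graph_union M1 M2) (disjoint_union H1 H2)"
    using graph_iso_disjoint_union[OF _ _ _ 1(3) 2(3)] M1 M2 S(3) by blast
  ultimately show ?thesis
    unfolding is_minor_def by (metis graph_union_commute rtranclp_trans)
qed

section \<open>Complete minors in dense graphs\<close>

definition cone :: "'a \<Rightarrow> 'a ugraph \<Rightarrow> 'a ugraph" where
  "cone v S = (insert v (verts S), edges S \<union> (\<lambda>x. {v, x}) ` verts S)"

text \<open>
  Contracting an edge away from the apex merges two spokes into one, so it yields the cone over the contracted
  graph.
\<close>
lemma contracts_to_cone:
  assumes "contracts_to\<^sup>*\<^sup>* S M" "simple_graph S" "v \<notin> verts S"
  shows "contracts_to\<^sup>*\<^sup>* (cone v S) (cone v M)"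
  using assms
proof (induction rule: rtranclp_induct)
  case (step M M')
  have M: "simple_graph M" "v \<notin> verts M"
    using contracts_to_simple[OF step.hyps(1) step.prems(1)] step.prems(2) by blast+
  obtain a b where ab: "{a, b} \<in> edges M" "M' = contract_edge a b M"
    using step.hyps(2) unfolding contracts_to_def by blast
  note abD = simple_graph_edgeE[OF M(1) ab(1)]
  let ?r = "\<lambda>x. if x = b then a else x"
  have spokes: "(\<lambda>x. ?r ` {v, x}) ` verts M = (\<lambda>x. {v, x}) ` (verts M - {b})"
  proof -
    have "(\<lambda>x. ?r ` {v, x}) ` verts M = (\<lambda>x. {v, x}) ` ?r ` verts M"
      unfolding image_image using M(2) abD by (intro image_cong) auto
    also have "?r ` verts M = verts M - {b}" using abD by force
    finally show ?thesis .
  qed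
  have "{a, b} \<notin> (\<lambda>x. {v, x}) ` verts M" using M(2) abD by (auto simp: doubleton_eq_iff)
  then have "contract_edge a b (cone v M) = cone v M'"
    unfolding ab(2) contract_edge_def cone_def using M(2) abD
    by (simp add: Un_Diff image_Un image_image spokes[simplified] insert_Diff_if) metis
  then have "contracts_to (cone v M) (cone v M')"
    unfolding contracts_to_def using ab(1) by (metis UnI1 cone_def snd_conv)
  then show ?case using step by (meson rtranclp.rtrancl_into_rtrancl)
qed simp

definition complete_graph :: "'a ugraph \<Rightarrow> bool" where
  "complete_graph K \<longleftrightarrow> edges K = {e. e \<subseteq> verts K \<and> card e = 2}"

lemma complete_graph_cone:
  assumes "complete_graph K" "v \<notin> verts K"
  shows "complete_graph (cone v K)"
proof -
  have "e \<in> edges (cone v K)" if e: "e \<subseteq> insert v (verts K)" "card e = 2" for e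
  proof -
    obtain a b where ab: "e = {a, b}" "a \<noteq> b" using e(2) by (meson card_2_iff)
    then show ?thesis
      using e assms by (auto simp: cone_def complete_graph_def insert_commute)
  qed
  then show ?thesis
    using assms by (auto simp: complete_graph_def cone_def card_insert_if)
qed

text \<open>
  Contracting \<open>uv\<close> loses that edge and merges \<open>ux\<close> with \<open>vx\<close> for every common neighbour \<open>x\<close>. Accordingly, the
  contraction is injective on the set \<open>E\<close> of edges other than \<open>uv\<close> and these \<open>vx\<close>.
\<close>
lemma card_edges_contract_edge:
  assumes G: "simple_graph G" "{u, v} \<in> edges G"
  shows "card (edges G)
    \<le> card (edges (contract_edge u v G)) + 1 + card {x. {u, x} \<in> edges G \<and> {v, x} \<in> edges G}"
proof -
  define r where "r x = (if x = v then u else x)" for x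
  define C where "C = {x. {u, x} \<in> edges G \<and> {v, x} \<in> edges G}"
  define E where "E = edges G - {{u, v}} - (\<lambda>x. {v, x}) ` C"
  note fin = simple_graph_finite[OF G(1)] and uv = simple_graph_edgeE[OF G]
  have finC: "finite C"
    using simple_graph_edgeE(3)[OF G(1)] by (intro finite_subset[OF _ fin(1)]) (auto simp: C_def)
  have r_id: "r ` e = e" if "v \<notin> e" for e
    using that by (force simp: r_def)
  have through_v: "\<exists>x. e = {v, x} \<and> x \<noteq> u \<and> x \<noteq> v \<and> {u, x} \<notin> edges G \<and> r ` e = {u, x}"
    if e: "e \<in> E" "v \<in> e" for e
  proof -
    have "e \<in> edges G" using e by (simp add: E_def)
    then obtain x where x: "e = {v, x}" "x \<noteq> v"
      using simple_graph_edgeD(2)[OF G(1)] e(2) by (metis card_2_iff insertE insert_commute singletonD)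
    moreover have "x \<noteq> u" using x e(1) by (auto simp: E_def insert_commute)
    moreover have "{u, x} \<notin> edges G" using x e(1) by (auto simp: E_def C_def)
    ultimately show ?thesis by (auto simp: r_def)
  qed
  have "inj_on (\<lambda>e. r ` e) E"
  proof (rule inj_onI)
    fix d e assume de: "d \<in> E" "e \<in> E" "r ` d = r ` e"
    have mix: False if "d \<in> E" "e \<in> E" "r ` d = r ` e" "v \<in> d" "v \<notin> e" for d e
      using through_v[OF that(1,4)] r_id[OF that(5)] that(2,3) by (auto simp: E_def)
    consider "v \<in> d" "v \<in> e" | "v \<notin> d" "v \<notin> e"
      using mix[OF de] mix[OF de(2,1) de(3)[symmetric]] by blast
    then show "d = e"
    proof cases
      case 1
      then show ?thesis
        using through_v[OF de(1)] through_v[OF de(2)] de(3) by (auto simp: doubleton_eq_iff)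
    next
      case 2
      then show ?thesis using r_id de(3) by metis
    qed
  qed
  then have "card E = card ((\<lambda>e. r ` e) ` E)" by (simp add: card_image)
  also have "\<dots> \<le> card (edges (contract_edge u v G))"
    using fin(2) by (intro card_mono) (auto simp: contract_edge_def E_def r_def[abs_def])
  finally have E: "card E \<le> card (edges (contract_edge u v G))" .
  have "edges G \<subseteq> E \<union> ({{u, v}} \<union> (\<lambda>x. {v, x}) ` C)" by (auto simp: E_def)
  then have "card (edges G) \<le> card (E \<union> ({{u, v}} \<union> (\<lambda>x. {v, x}) ` C))"
    using fin(2) finC by (intro card_mono) (auto simp: E_def)
  also have "\<dots> \<le> card E + (card {{u, v}} + card ((\<lambda>x. {v, x}) ` C))"
    by (meson add_left_mono card_Un_le order_trans)
  also have "\<dots> \<le> card E + (1 + card C)"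
    using finC by (simp add: card_image_le)
  finally show ?thesis using E by (simp add: C_def)
qed

text \<open>
  A form of Mader's theorem, by induction on \<open>p\<close>. Let \<open>M\<close> be a minor of \<open>G\<close> with as few vertices as possible
  among those that keep the density \<open>2 ^ Suc p\<close>. Contracting an edge removes one vertex, so by
  minimality it loses more than \<open>2 ^ Suc p\<close> edges; hence the ends of every edge have at least \<open>2 ^ Suc p\<close> common
  neighbours. So the neighbourhood of a vertex \<open>v\<close> induces a graph with minimum degree at least
  \<open>2 ^ Suc p\<close>, thus with density at least \<open>2 ^ p\<close>, and the cone with apex \<open>v\<close> over a complete minor of it is a
  complete minor with one more vertex.
\<close>
lemma dense_graph_complete_minor:
  assumes "simple_graph G" "non_null G" "2 ^ p * card (verts G) \<le> card (edges G)"
  shows "\<exists>K. reduces_to G K \<and> complete_graph K \<and> card (verts K) = p"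
  using assms
proof (induction p arbitrary: G)
  case 0
  have "is_subgraph ({}, {}) G" by (simp add: is_subgraph_def simple_graph_def)
  then have "reduces_to G ({}, {})" unfolding reduces_to_def by blast
  then show ?case by (intro exI[of _ "({}, {})"]) (auto simp: complete_graph_def)
next
  case (Suc p)
  define good where "good M \<longleftrightarrow> reduces_to G M \<and> non_null M \<and> 2 ^ Suc p * card (verts M) \<le> card (edges M)" for M
  have "reduces_to G G"
    using Suc.prems(1) unfolding reduces_to_def is_subgraph_def by blast
  then have "good G" using Suc.prems by (simp add: good_def)
  then obtain M where M: "good M" and least: "\<And>N. good N \<Longrightarrow> card (verts M) \<le> card (verts N)"
    using arg_min_natI[of good G "\<lambda>M. card (verts M)"] arg_min_nat_le[of good _ "\<lambda>M. card (verts M)"] by blast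
  have sM: "simple_graph M" using M reduces_to_simple unfolding good_def by blast
  note fin = simple_graph_finite[OF sM]
  have "non_null M" using M by (simp add: good_def)
  then have "0 < 2 ^ Suc p * card (verts M)" using card_verts_pos[OF sM] by simp
  also have "\<dots> \<le> card (edges M)" using M unfolding good_def by blast
  finally have "card (edges M) > 0" .
  then obtain e where e: "e \<in> edges M" by fastforce
  then obtain v w where vw: "{v, w} \<in> edges M"
    using simple_graph_edgeD(2)[OF sM e] by (metis card_2_iff)
  have common: "2 ^ Suc p \<le> card {x. {u, x} \<in> edges M \<and> {v, x} \<in> edges M}" if uv: "{u, v} \<in> edges M" for u
  proof (rule ccontr)
    assume few: "\<not> ?thesis"
    define N where "N = contract_edge u v M"
    note uvD = simple_graph_edgeE[OF sM uv]
    have cN: "card (verts N) + 1 = card (verts M)"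
      using card_Suc_Diff1[OF fin(1) uvD(3)] by (simp add: N_def contract_edge_def)
    have "2 ^ Suc p * (card (verts N) + 1) \<le> card (edges N) + 1
        + card {x. {u, x} \<in> edges M \<and> {v, x} \<in> edges M}"
      using card_edges_contract_edge[OF sM uv] M unfolding cN good_def N_def[symmetric] by linarith
    with few have "2 ^ Suc p * card (verts N) \<le> card (edges N)" by (simp add: algebra_simps)
    moreover have "non_null N" using uvD by (auto simp: non_null_def N_def contract_edge_def)
    moreover have "reduces_to M N"
      using uv sM unfolding reduces_to_def N_def is_subgraph_def contracts_to_def by blast
    then have "reduces_to G N" using M reduces_to_trans unfolding good_def by blast
    ultimately have "good N" by (simp add: good_def)
    then show False using least cN by fastforce
  qed
  define A where "A = {u. {v, u} \<in> edges M}"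
  have A: "A \<subseteq> verts M" "v \<notin> A" "A \<noteq> {}"
    using simple_graph_edgeE[OF sM] vw unfolding A_def by blast+
  define I where "I = induced M A"
  have sI: "simple_graph I" using simple_graph_induced[OF sM A(1)] by (simp add: I_def)
  have vI: "verts I = A" by (simp add: I_def induced_def)
  have "2 ^ Suc p \<le> degree I u" if "u \<in> A" for u
  proof -
    have "{x. {u, x} \<in> edges I} = {x. {u, x} \<in> edges M \<and> {v, x} \<in> edges M}"
      using that by (auto simp: I_def induced_def A_def)
    then show ?thesis
      using common[of u] that by (simp add: degree_eq_card_neighbours[OF sI] A_def insert_commute)
  qed
  then have "card A * 2 ^ Suc p \<le> (\<Sum>u\<in>A. degree I u)"
    using sum_bounded_below[of A "2 ^ Suc p" "degree I"] by simp
  then have "2 ^ p * card (verts I) \<le> card (edges I)"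
    using handshake[OF sI] by (simp add: vI mult.commute)
  moreover have "non_null I" using A vI by (simp add: non_null_def)
  ultimately obtain K where K: "reduces_to I K" "complete_graph K" "card (verts K) = p"
    using Suc.IH[OF sI] by blast
  obtain S where S: "is_subgraph S I" "contracts_to\<^sup>*\<^sup>* S K" using K(1) unfolding reduces_to_def by blast
  have vS: "v \<notin> verts S" and SA: "verts S \<subseteq> A" and sS: "simple_graph S"
    using S(1) A(2) vI by (auto simp: is_subgraph_def)
  have "is_subgraph (cone v S) M"
  proof -
    have "{v, x} \<in> edges M" if "x \<in> verts S" for x using that SA by (auto simp: A_def)
    moreover have "edges S \<subseteq> edges M" using S(1) by (auto simp: is_subgraph_def I_def induced_def)
    moreover have "v \<in> verts M" using simple_graph_edgeE[OF sM vw] by blast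
    ultimately show ?thesis
      using SA A(1) sS simple_graph_edgeD(2)[OF sM]
      by (auto simp: is_subgraph_def cone_def simple_graph_def)
  qed
  then have "reduces_to M (cone v K)"
    using contracts_to_cone[OF S(2) sS vS] unfolding reduces_to_def by blast
  then have "reduces_to G (cone v K)" using M reduces_to_trans unfolding good_def by blast
  moreover have "v \<notin> verts K" "finite (verts K)"
    using contracts_to_simple[OF S(2) sS] vS simple_graph_finite by blast+
  ultimately show ?case
    using complete_graph_cone[OF K(2)] K(3) by (intro exI[of _ "cone v K"]) (auto simp: cone_def)
qed

text \<open>A complete graph contains a copy of every graph on as many vertices.\<close>
lemma is_minor_of_complete:
  assumes G: "reduces_to G K" "complete_graph K"
    and H: "simple_graph H" "card (verts K) = card (verts H)"
  shows "is_minor H G"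
proof -
  have sK: "simple_graph K" using G(1) reduces_to_simple by blast
  obtain f where f: "bij_betw f (verts H) (verts K)"
    using H(2) simple_graph_finite(1)[OF H(1)] simple_graph_finite(1)[OF sK]
    by (metis finite_same_card_bij)
  define T where "T = (verts K, (\<lambda>e. f ` e) ` edges H)"
  have img: "f ` e \<subseteq> verts K \<and> card (f ` e) = 2" if "e \<in> edges H" for e
  proof -
    note e = simple_graph_edgeD[OF H(1) that]
    have "card (f ` e) = card e"
      using e(1) f by (meson bij_betw_imp_inj_on card_image inj_on_subset)
    then show ?thesis using e f by (auto simp: bij_betw_def)
  qed
  then have "simple_graph T" "edges T \<subseteq> edges K"
    using simple_graph_finite(1)[OF sK] G(2)
    unfolding T_def simple_graph_def complete_graph_def by auto
  then have "is_subgraph T K" by (simp add: is_subgraph_def T_def)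
  then have "reduces_to G T" using reduces_to_trans[OF G(1)] unfolding reduces_to_def by blast
  moreover have "graph_iso T H"
  proof -
    let ?g = "inv_into (verts H) f"
    have "?g ` f ` e = e" if "e \<in> edges H" for e
      using simple_graph_edgeD(1)[OF H(1) that] f
      by (meson bij_betw_imp_inj_on inv_into_image_cancel)
    then have "edges H = (\<lambda>e. ?g ` e) ` edges T"
      by (force simp: T_def image_image)
    then show ?thesis
      using bij_betw_inv_into[OF f] unfolding graph_iso_def T_def by auto
  qed
  ultimately show ?thesis unfolding is_minor_iff by blast
qed

section \<open>The extremal constant of a disjoint union\<close>

lemma bdd_above_minor_free_densities:
  assumes "simple_graph H"
  shows "bdd_above (insert 0 {real (card (edges G)) / real (card (verts G)) | G :: nat ugraph.
      simple_graph G \<and> non_null G \<and> \<not> is_minor H G})"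
proof (rule bdd_aboveI)
  fix d
  assume "d \<in> insert 0 {real (card (edges G)) / real (card (verts G)) | G :: nat ugraph.
      simple_graph G \<and> non_null G \<and> \<not> is_minor H G}"
  then consider "d = 0" | G :: "nat ugraph" where
    "d = real (card (edges G)) / real (card (verts G))" "simple_graph G" "non_null G" "\<not> is_minor H G"
    by blast
  then show "d \<le> 2 ^ card (verts H)"
  proof cases
    case 2
    have "\<not> 2 ^ card (verts H) * card (verts G) \<le> card (edges G)"
      using dense_graph_complete_minor[OF 2(2,3)] is_minor_of_complete[OF _ _ assms] 2(4) by blast
    then have "card (edges G) \<le> 2 ^ card (verts H) * card (verts G)" by simp
    then have "real (card (edges G)) \<le> 2 ^ card (verts H) * real (card (verts G))"
      by (metis of_nat_le_iff of_nat_mult of_nat_numeral of_nat_power)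
    moreover have "card (verts G) > 0"
      using card_verts_pos[OF 2(2,3)] .
    ultimately show ?thesis using 2(1) by (simp add: divide_le_eq)
  qed simp
qed

lemma minor_density_nonneg: "simple_graph H \<Longrightarrow> 0 \<le> minor_density H"
  unfolding minor_density_def by (intro cSup_upper insertI1 bdd_above_minor_free_densities)

lemma is_minor_if_dense:
  fixes G :: "nat ugraph"
  assumes "simple_graph H" "simple_graph G" "non_null G"
    and "minor_density H * card (verts G) < card (edges G)"
  shows "is_minor H G"
proof (rule ccontr)
  assume "\<not> is_minor H G"
  then have "real (card (edges G)) / real (card (verts G)) \<le> minor_density H"
    unfolding minor_density_def using assms(2,3)
    by (intro cSup_upper bdd_above_minor_free_densities[OF assms(1)]) blast
  moreover have "card (verts G) > 0"
    using card_verts_pos[OF assms(2,3)] .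
  ultimately show False using assms(4) by (simp add: divide_le_eq)
qed

theorem corollary2:
  fixes H1 :: "'a ugraph" and H2 :: "'b ugraph"
  assumes "simple_graph H1" and "non_null H1"
    and "simple_graph H2" and "non_null H2"
  shows "minor_density (disjoint_union H1 H2) \<le> minor_density H1 + minor_density H2 + 1"
proof -
  define c1 where "c1 = minor_density H1"
  define c2 where "c2 = minor_density H2"
  have c: "0 \<le> c1" "0 \<le> c2"
    unfolding c1_def c2_def by (intro minor_density_nonneg assms)+
  have bound: "real (card (edges G)) / real (card (verts G)) \<le> c1 + c2 + 1"
    if G: "simple_graph G" "non_null G" "\<not> is_minor (disjoint_union H1 H2) G" for G :: "nat ugraph"
  proof (rule ccontr)
    assume dense: "\<not> ?thesis"
    \<comment> \<open>The surplus is shared equally: the bounds \<open>c1 + h\<close> and \<open>c2 + h\<close> from the split then exceed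
      \<open>c1\<close> and \<open>c2\<close> strictly, as needed to force the minors.\<close>
    define D where "D = real (card (edges G)) / real (card (verts G))"
    define h where "h = (D - (c1 + c2 + 1)) / 2"
    have h: "h > 0" using dense by (simp add: h_def D_def)
    have n: "card (verts G) > 0"
      using card_verts_pos[OF G(1,2)] .
    have "((c1 + h) + (c2 + h) + 1) * card (verts G) \<le> card (edges G)"
      using n by (simp add: h_def D_def)
    then obtain A where A: "A \<subset> verts G" "A \<noteq> {}" "(c1 + h) * card A \<le> inner_edges G A"
      "(c2 + h) * card (verts G - A) \<le> inner_edges G (verts G - A)"
      using dense_bipartition[OF G(1,2), of "c1 + h" "c2 + h"] c h by auto
    define B where "B = verts G - A"
    have fin: "finite A" "finite B" "B \<noteq> {}"
      using A(1) simple_graph_finite(1)[OF G(1)] finite_subset by (auto simp: B_def)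
    have "0 < h * card A" "0 < h * card B"
      using h fin A(2) by (simp_all add: card_gt_0_iff)
    then have "c1 * card A < inner_edges G A" "c2 * card B < inner_edges G B"
      using A(3,4) unfolding B_def[symmetric] by (simp_all add: algebra_simps)
    moreover have sub: "is_subgraph (induced G A) G" "is_subgraph (induced G B) G"
      using A(1) by (intro induced_is_subgraph[OF G(1)]; auto simp: B_def)+
    then have "simple_graph (induced G A)" "simple_graph (induced G B)"
      by (simp_all add: is_subgraph_def)
    moreover have "non_null (induced G A)" "non_null (induced G B)"
      using A(2) fin(3) by (simp_all add: non_null_def induced_def)
    moreover have "verts (induced G A) = A" "verts (induced G B) = B"
      by (simp_all add: induced_def)
    ultimately have "is_minor H1 (induced G A)" "is_minor H2 (induced G B)"
      using is_minor_if_dense[OF assms(1), of "induced G A"]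
        is_minor_if_dense[OF assms(3), of "induced G B"] by (simp_all add: c1_def c2_def)
    moreover have "verts (induced G A) \<inter> verts (induced G B) = {}"
      by (auto simp: induced_def B_def)
    ultimately show False
      using is_minor_disjoint_union[OF sub] G(3) by blast
  qed
  show ?thesis
    unfolding minor_density_def[of "disjoint_union H1 H2"] c1_def[symmetric] c2_def[symmetric]
  proof (rule cSup_least)
    fix d
    assume "d \<in> insert 0 {real (card (edges G)) / real (card (verts G)) | G :: nat ugraph.
      simple_graph G \<and> non_null G \<and> \<not> is_minor (disjoint_union H1 H2) G}"
    then show "d \<le> c1 + c2 + 1" using bound c by (elim insertE CollectE exE conjE) simp_all
  qed simp
qed

end
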